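(* Let $\vec d=(\vec a,\vec b)$ be a bidegree sequence of length $n$ with the entries of $\vec a$ in non-increasing order and $\sum_{i=1}^n a_i=\sum_{i=1}^n b_i=n\bar c$. Let $M_a=\max_i a_i$ and $M_b=\max_i b_i$. If $M_aM_b\le n\bar c+1$, then $\vec d$ is graphic with loops. In particular, if $\max_i a_i=\max_i b_i$ and $\max\vec d\le\lfloor\sqrt{n\bar c+1}\rfloor$, then $\vec d$ is graphic with loops.
   Context: A bidegree sequence of length $n$ is a pair $\vec d=(\vec a,\vec b)$ with $\vec a=(a_1,\dots,a_n)\in\mathbb{N}_0^n$ and $\vec b=(b_1,\dots,b_n)\in\mathbb{N}_0^n$. It is graphic with loops if there is an $n\times n$ matrix with entries in $\{0,1\}$ whose $i$th row sum is $a_i$ and whose $i$th column sum is $b_i$ for every $i\in[1..n]$; it is graphic if such a matrix exists with all diagonal entries equal to $0$. $\max\vec d$ and $\min\vec d$ denote the maximum and minimum over all $2n$ entries $a_1,\dots,a_n,b_1,\dots,b_n$. The number $\bar c$ (the average degree) is defined by $\sum_i a_i=\sum_i b_i=n\bar c$. *)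

theory Defs
  imports Main "HOL-Library.Discrete_Functions"
begin

text \<open>A bidegree sequence of length n is represented by two functions a b :: nat => nat,
  of which only the values at indices 0..<n matter. A 0/1 matrix is a predicate
  M :: nat => nat => bool on index pairs (i,j) with i,j < n.\<close>

definition graphic_with_loops :: "nat \<Rightarrow> (nat \<Rightarrow> nat) \<Rightarrow> (nat \<Rightarrow> nat) \<Rightarrow> bool" where
  "graphic_with_loops n a b \<longleftrightarrow>
     (\<exists>M :: nat \<Rightarrow> nat \<Rightarrow> bool.
        (\<forall>i<n. card {j. j < n \<and> M i j} = a i) \<and>
        (\<forall>j<n. card {i. i < n \<and> M i j} = b j))"

end

theory Submission
  imports Defs
begin

text \<open>
  Induct on the total degree \<open>S\<close>. Let \<open>A\<close> and \<open>B\<close> be the largest row and column sums, and transpose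
  if necessary so that \<open>A \<le> B\<close>. Fill a row of sum \<open>A\<close> with ones, in columns of sum \<open>B\<close> as far as
  possible. If this uses all columns of sum \<open>B\<close>, then \<open>B\<close> drops by one, and
  \<open>A * (B - 1) \<le> (S - A) + 1\<close>. Otherwise there are at least \<open>A + 1\<close> columns of sum \<open>B\<close>, so that
  \<open>S \<ge> A * B + B \<ge> A * B + A\<close>. In both cases the inequality persists when the row is deleted.
\<close>

text \<open>Arbitrary index sets let any row or column be deleted without renumbering the
  others.\<close>

definition realizable :: "'a set \<Rightarrow> 'b set \<Rightarrow> ('a \<Rightarrow> nat) \<Rightarrow> ('b \<Rightarrow> nat) \<Rightarrow> bool" where
  "realizable I J a b \<longleftrightarrow>
     (\<exists>R. (\<forall>i\<in>I. card {j\<in>J. R i j} = a i) \<and> (\<forall>j\<in>J. card {i\<in>I. R i j} = b j))"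

lemma realizable_transpose:
  assumes "realizable J I b a"
  shows "realizable I J a b"
proof -
  obtain R where "\<forall>j\<in>J. card {i\<in>I. R j i} = b j" "\<forall>i\<in>I. card {j\<in>J. R j i} = a i"
    using assms unfolding realizable_def by blast
  then show ?thesis
    unfolding realizable_def by (intro exI[of _ "\<lambda>i j. R j i"]) blast
qed

lemma realizable_zero:
  assumes "\<forall>i\<in>I. a i = 0" "\<forall>j\<in>J. b j = 0"
  shows "realizable I J a b"
  using assms unfolding realizable_def by (intro exI[of _ "\<lambda>_ _. False"]) simp

text \<open>Row \<open>i0\<close> gets its ones exactly on \<open>T\<close>, and \<open>R\<close>
  supplies the other rows. Positivity of \<open>b\<close> on \<open>T\<close> makes the truncated
  \<open>b j - 1\<close> a true predecessor.\<close>

lemma realizable_insert_row: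
  assumes "finite I" "i0 \<in> I" "T \<subseteq> J" "card T = a i0" "\<forall>j\<in>T. 0 < b j"
    and "realizable (I - {i0}) J a (\<lambda>j. if j \<in> T then b j - 1 else b j)"
  shows "realizable I J a b"
proof -
  obtain R where R: "\<forall>i\<in>I - {i0}. card {j\<in>J. R i j} = a i"
      "\<forall>j\<in>J. card {i\<in>I - {i0}. R i j} = (if j \<in> T then b j - 1 else b j)"
    using assms(6) unfolding realizable_def by blast
  define Q where "Q i j = (if i = i0 then j \<in> T else R i j)" for i j
  have "card {j\<in>J. Q i j} = a i" if "i \<in> I" for i
  proof (cases "i = i0")
    case True
    then have "{j\<in>J. Q i j} = T"
      using assms(3) by (auto simp: Q_def)
    then show ?thesis
      using True assms(4) by simp
  next
    case False
    then show ?thesis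
      using R(1) that by (simp add: Q_def)
  qed
  moreover have "card {i\<in>I. Q i j} = b j" if "j \<in> J" for j
  proof (cases "j \<in> T")
    case True
    then have "{i\<in>I. Q i j} = insert i0 {i\<in>I - {i0}. R i j}"
      using assms(2) by (auto simp: Q_def)
    then have "card {i\<in>I. Q i j} = Suc (card {i\<in>I - {i0}. R i j})"
      using assms(1) by simp
    then show ?thesis
      using R(2) True assms(5) that by auto
  next
    case False
    then have "{i\<in>I. Q i j} = {i\<in>I - {i0}. R i j}"
      by (auto simp: Q_def)
    then show ?thesis
      using R(2) False that by simp
  qed
  ultimately show ?thesis
    unfolding realizable_def by blast
qed

text \<open>The induction step for one orientation. The induction hypothesis enters as
  \<open>rest\<close>, so that the same argument serves for deleting a row and, with the roles
  swapped, a column.\<close>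

lemma realizable_delete_max_row:
  assumes fin: "finite I" "finite J"
    and i0: "i0 \<in> I" "\<forall>i\<in>I. a i \<le> a i0"
    and j0: "j0 \<in> J" "\<forall>j\<in>J. b j \<le> b j0"
    and pos: "0 < b j0"
    and le: "a i0 \<le> b j0"
    and sums: "sum a I = sum b J"
    and prod: "a i0 * b j0 \<le> sum a I + 1"
    and rest: "\<And>b'. sum a (I - {i0}) = sum b' J \<Longrightarrow>
      \<forall>i\<in>I - {i0}. \<forall>j\<in>J. a i * b' j \<le> sum a (I - {i0}) + 1 \<Longrightarrow>
      realizable (I - {i0}) J a b'"
  shows "realizable I J a b"
proof -
  define A where "A = a i0"
  define B where "B = b j0"
  define X where "X = {j\<in>J. b j = B}"
  define P where "P = {j\<in>J. 0 < b j}"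
  have finXP: "finite X" "finite P" and XP: "X \<subseteq> P" and PJ: "P \<subseteq> J" and j0P: "j0 \<in> P"
    using fin j0 pos by (auto simp: X_def P_def B_def)
  have S: "sum a I = A + sum a (I - {i0})"
    unfolding A_def using fin(1) i0(1) by (rule sum.remove)
  \<comment> \<open>Enough columns of positive sum exist to hold \<open>A\<close> ones. Otherwise
    \<open>(card P + 1) * B \<le> A * B \<le> card P * B + 1\<close>, which gives
    \<open>B \<le> 1\<close>; then \<open>A \<le> B \<le> 1 \<le> card P\<close>, a
    contradiction.\<close>
  have "A \<le> card P"
  proof (rule ccontr)
    assume "\<not> A \<le> card P"
    then have "(card P + 1) * B \<le> A * B"
      by (intro mult_right_mono) auto
    moreover have "sum b J = sum b P"
      using fin(2) by (intro sum.mono_neutral_right) (auto simp: P_def)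
    moreover have "sum b P \<le> card P * B"
      using sum_bounded_above[of P b B] j0(2) by (auto simp: P_def B_def)
    ultimately have "B \<le> 1"
      using prod sums by (simp add: A_def B_def)
    moreover have "0 < card P"
      using finXP j0P card_gt_0_iff by blast
    ultimately show False
      using \<open>\<not> A \<le> card P\<close> le by (simp add: A_def B_def)
  qed
  \<comment> \<open>Beyond \<open>X\<close> any columns of positive sum will do, since only the
    largest column sum enters the bound. A tie \<open>card X = A\<close> falls under
    \<open>X \<subseteq> T\<close>.\<close>
  have "\<exists>T. T \<subseteq> P \<and> card T = A \<and> (X \<subseteq> T \<or> T \<subseteq> X \<and> A < card X)"
  proof (cases "card X \<le> A")
    case True
    then show ?thesis
      using exists_subset_between[OF True \<open>A \<le> card P\<close> XP finXP(2)] by blast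
  next
    case False
    then obtain T where "T \<subseteq> X" "card T = A"
      using obtain_subset_with_card_n[of A X] by auto
    then show ?thesis
      using False XP by (intro exI[of _ T]) auto
  qed
  then obtain T where T: "T \<subseteq> P" "card T = A" "X \<subseteq> T \<or> T \<subseteq> X \<and> A < card X"
    by blast
  define b' where "b' = (\<lambda>j. if j \<in> T then b j - 1 else b j)"
  \<comment> \<open>On \<open>T\<close>, a subset of \<open>P\<close>, the subtraction is not
    truncated, so the column total drops by exactly \<open>card T\<close>.\<close>
  have "sum b J = (\<Sum>j\<in>J. b' j + (if j \<in> T then 1 else 0))"
    using T(1) by (intro sum.cong) (auto simp: b'_def P_def)
  also have "\<dots> = sum b' J + card (J \<inter> T)"
    using fin(2) by (simp add: sum.distrib sum.inter_restrict[symmetric])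
  also have "J \<inter> T = T"
    using T(1) PJ by blast
  finally have sum': "sum a (I - {i0}) = sum b' J"
    using sums S T(2) by simp
  have "a i * b' j \<le> sum a (I - {i0}) + 1" if "i \<in> I - {i0}" "j \<in> J" for i j
    using T(3)
  proof
    assume "X \<subseteq> T"
    \<comment> \<open>A column in \<open>T\<close> loses one, and a column outside \<open>T\<close>
      is outside \<open>X\<close>, hence already below \<open>B\<close>.\<close>
    have "b j \<le> B" "j \<notin> T \<Longrightarrow> b j \<noteq> B"
      using j0(2) that \<open>X \<subseteq> T\<close> by (auto simp: B_def X_def)
    then have "b' j \<le> B - 1"
      by (auto simp: b'_def)
    moreover have "a i \<le> A"
      using i0(2) that by (simp add: A_def)
    ultimately have "a i * b' j \<le> A * (B - 1)"
      by (intro mult_le_mono)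
    also have "\<dots> = A * B - A"
      by (simp add: diff_mult_distrib2)
    also have "\<dots> \<le> sum a (I - {i0}) + 1"
      using prod S by (simp add: A_def B_def)
    finally show ?thesis .
  next
    assume "T \<subseteq> X \<and> A < card X"
    then have "(A + 1) * B \<le> card X * B"
      by (intro mult_right_mono) auto
    also have "\<dots> = sum b X"
      by (simp add: X_def)
    also have "\<dots> \<le> sum b J"
      using fin(2) by (intro sum_mono2) (auto simp: X_def)
    finally have "A * B \<le> sum a (I - {i0})"
      using S sums le by (simp add: A_def B_def)
    moreover have "a i \<le> A" "b' j \<le> B"
      using i0(2) j0(2) that by (auto simp: A_def B_def b'_def intro: diff_le_self[THEN le_trans])
    then have "a i * b' j \<le> A * B"
      by (intro mult_le_mono)
    ultimately show ?thesis
      by linarith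
  qed
  then have "realizable (I - {i0}) J a b'"
    using rest[OF sum'] by blast
  then show ?thesis
    using realizable_insert_row[of I i0 T J a b] fin(1) i0(1) T PJ
    by (auto simp: b'_def A_def P_def)
qed

text \<open>Bounding each product instead of a product of maxima keeps the hypothesis meaningful
  when deletion empties an index set. Both index sets share one type because the induction
  hypothesis is also applied with \<open>I\<close> and \<open>J\<close> interchanged.\<close>

theorem realizable_if_products_le:
  fixes I J :: "'a set"
  assumes "finite I" "finite J" "sum a I = sum b J"
    and "\<forall>i\<in>I. \<forall>j\<in>J. a i * b j \<le> sum a I + 1"
  shows "realizable I J a b"
  using assms
proof (induction "sum a I" arbitrary: I J a b rule: less_induct)
  case less
  show ?case
  proof (cases "sum a I = 0")
    case True
    then show ?thesis
      using less.prems by (intro realizable_zero) auto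
  next
    case False
    then have "I \<noteq> {}" "J \<noteq> {}"
      using less.prems by auto
    have max: "\<exists>x\<in>K. \<forall>y\<in>K. f y \<le> f x" if "finite K" "K \<noteq> {}" for K :: "'a set" and f :: "'a \<Rightarrow> nat"
    proof -
      have "Max (f ` K) \<in> f ` K"
        using that by (intro Max_in) auto
      then obtain x where "x \<in> K" "Max (f ` K) = f x"
        by blast
      then show ?thesis
        using that(1) by (metis Max_ge finite_imageI imageI)
    qed
    obtain i0 j0 where i0: "i0 \<in> I" "\<forall>i\<in>I. a i \<le> a i0"
      and j0: "j0 \<in> J" "\<forall>j\<in>J. b j \<le> b j0"
      using max[OF less.prems(1) \<open>I \<noteq> {}\<close>, of a] max[OF less.prems(2) \<open>J \<noteq> {}\<close>, of b] by blast
    have pos: "0 < a i0" "0 < b j0"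
    proof -
      show "0 < a i0"
        using False i0(2) by (metis bot_nat_0.not_eq_extremum le_0_eq sum.neutral)
      show "0 < b j0"
        using False less.prems(3) j0(2)
        by (metis bot_nat_0.not_eq_extremum le_0_eq sum.neutral)
    qed
    have prod: "a i0 * b j0 \<le> sum a I + 1"
      using less.prems(4) i0(1) j0(1) by blast
    show ?thesis
    proof (cases "a i0 \<le> b j0")
      case True
      have "sum a (I - {i0}) < sum a I"
        using sum.remove[OF less.prems(1) i0(1), of a] pos by simp
      then show ?thesis
        using less.prems(1,2)
        by (intro realizable_delete_max_row[OF less.prems(1,2) i0 j0 pos(2) True less.prems(3) prod]
            less.hyps) auto
    next
      case False
      \<comment> \<open>In the transposed problem the measure is the column total, which equals
        \<open>sum a I\<close>; deleting the positive column sum \<open>b j0\<close> lowers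
        it.\<close>
      have "sum b (J - {j0}) < sum a I"
        using sum.remove[OF less.prems(2) j0(1), of b] pos less.prems(3) by simp
      then have "realizable J I b a"
        using less.prems False prod
        by (intro realizable_delete_max_row[OF less.prems(2,1) j0 i0 pos(1)] less.hyps)
          (auto simp: mult.commute)
      then show ?thesis
        by (rule realizable_transpose)
    qed
  qed
qed

theorem theorem3:
  fixes n :: nat and a b :: "nat \<Rightarrow> nat"
  assumes n_pos: "n \<ge> 1"
    and sorted_a: "\<And>i j. i \<le> j \<Longrightarrow> j < n \<Longrightarrow> a j \<le> a i"
    and sums_eq: "(\<Sum>i<n. a i) = (\<Sum>i<n. b i)"
  shows "(Max (a ` {..<n}) * Max (b ` {..<n}) \<le> (\<Sum>i<n. a i) + 1
            \<longrightarrow> graphic_with_loops n a b)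
       \<and> (Max (a ` {..<n}) = Max (b ` {..<n})
            \<and> real (Max (a ` {..<n} \<union> b ` {..<n})) \<le> of_int \<lfloor>sqrt (real (\<Sum>i<n. a i) + 1)\<rfloor>
            \<longrightarrow> graphic_with_loops n a b)"
proof -
  let ?A = "Max (a ` {..<n})" and ?B = "Max (b ` {..<n})" and ?S = "\<Sum>i<n. a i"
  have graphic: "graphic_with_loops n a b" if "?A * ?B \<le> ?S + 1"
  proof -
    have "a i * b j \<le> ?S + 1" if "i < n" "j < n" for i j
    proof -
      have "a i * b j \<le> ?A * ?B"
        using that by (intro mult_le_mono Max_ge) auto
      then show ?thesis
        using \<open>?A * ?B \<le> ?S + 1\<close> by linarith
    qed
    then have "realizable {..<n} {..<n} a b"
      using sums_eq by (intro realizable_if_products_le) auto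
    then show ?thesis
      by (simp add: realizable_def graphic_with_loops_def Ball_def)
  qed
  moreover have "?A * ?B \<le> ?S + 1"
    if eq: "?A = ?B"
      and le: "real (Max (a ` {..<n} \<union> b ` {..<n})) \<le> of_int \<lfloor>sqrt (real ?S + 1)\<rfloor>"
  proof -
    \<comment> \<open>As \<open>n\<close> is positive, both images are nonempty and
      \<open>Max\<close> splits over the union. Dropping the floor and squaring then gives the
      product bound.\<close>
    have "Max (a ` {..<n} \<union> b ` {..<n}) = ?A"
      using n_pos eq by (subst Max_Un) (auto simp: lessThan_empty_iff)
    then have "real ?A \<le> sqrt (real ?S + 1)"
      using le by linarith
    then have "(real ?A)\<^sup>2 \<le> (sqrt (real ?S + 1))\<^sup>2"
      by (intro power_mono) auto
    also have "\<dots> = real ?S + 1"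
      by (intro real_sqrt_pow2) (simp add: add_nonneg_nonneg sum_nonneg)
    finally have "real (?A * ?A) \<le> real (?S + 1)"
      by (simp add: power2_eq_square)
    then have "?A * ?A \<le> ?S + 1"
      by (simp only: of_nat_le_iff)
    then show ?thesis
      using eq by simp
  qed
  ultimately show ?thesis
    by blast
qed

end
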